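(* Let $W_1(z),W_2(z)$ be the currents defined in the context, written in terms of the Heisenberg algebra $\mathcal H$ through the realization given there, with $q_1=e^{\hbar}$, $q_2=e^{(\beta-1)\hbar}$, $q_3=e^{-\beta\hbar}$ and $\beta$ fixed. Then the $\hbar$-expansions of $W_i(z)$ are of the forms $$W_1(z)=\sqrt2\,\widetilde\psi(z)+\frac{\sqrt{-2\beta}}{2}\,G(z)\,z\,\hbar+O(\hbar^2),$$ $$W_2(z)=\sqrt2\,\widetilde\psi(z)-\frac{\sqrt{-2\beta}}{2}\,G(z)\,z\,\hbar+O(\hbar^2),$$ where $G(z)=\,:\widetilde\phi'(z):\psi(z)+2\sigma\psi'(z)$ with $\sigma=\dfrac{1-\beta}{2\sqrt\beta}$.
   Context: Heisenberg algebra $\mathcal H$: generators $a_n,Q,\widetilde a_n,\widetilde Q$ ($n\in\mathbb Z$) with $[a_n,a_m]=[\widetilde a_n,\widetilde a_m]=n\delta_{n+m,0}$, $[a_n,\widetilde a_m]=0$, $[a_n,Q]=[\widetilde a_n,\widetilde Q]=\delta_{n,0}$, $[a_n,\widetilde Q]=[\widetilde a_n,Q]=0$. The symbol $:\ast:$ is the usual normal ordering (generators with $n<0$ and $Q,\widetilde Q$ to the left; generators with $n\ge0$ to the right). Free bosonic fields: $\phi(z)=Q+a_0\log z-\sum_{n\ne0}\frac1n a_nz^{-n}$, $\widetilde\phi(z)=\widetilde Q+\widetilde a_0\log z-\sum_{n\neq0}\frac1n\widetilde a_nz^{-n}$. Primes denote $\frac{d}{dz}$. Fermionic fields (boson–fermion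 correspondence): $\psi(z)=\frac1{\sqrt{-2}}(:e^{\phi(z)}:-:e^{-\phi(z)}:)$, $\widetilde\psi(z)=\frac1{\sqrt2}(:e^{\phi(z)}:+:e^{-\phi(z)}:)$. Square roots are taken consistently: $\sqrt{-2\beta}=\sqrt{-2}\sqrt\beta$. Currents: let $q=e^{(\beta-1)\hbar/2}$ (so $q_2=q^2$, $q_1q_2q_3=1$). For $i=1,2$ set $W_i(z)=\Lambda_i^+(z)+\Lambda_i^-(z)$ with $$\Lambda_i^+(z)=:\exp\Big(-\sum_{n\ne0}\frac{q^n}{n}h^\perp_{i,n}z^{-n}\Big):e^{Q_i^\perp}(q^{-1}z)^{h^\perp_{i,0}}q_1^{\mathsf a_0^\perp},\qquad \Lambda_i^-(z)=:\exp\Big(\sum_{n\ne0}\frac{q^{-n}}{n}h^\perp_{i,n}z^{-n}\Big):e^{-Q_i^\perp}(qz)^{-h^\perp_{i,0}}q_1^{-\mathsf a_0^\perp}.$$ The generators $h^\perp_{i,n},Q^\perp_i,\mathsf a^\perp_0,\mathsf Q^\perp$ satisfy $[h^\perp_{i,n},h^\perp_{i,m}]=n\delta_{n+m,0}$, $[h^\perp_{i,n},h^\perp_{j,m}]=-n\frac{q_1^n+q_3^n}{1+q_2^{-n}}\delta_{n+m,0}$ ($i\ne j$), $[h^\perp_{i,0},Q^\perp_i]=1$, $[h^\perp_{i,0},Q^\perp_j]=-1$ ($i\neq j$), $[\mathsf a_0^\perp,\mathsf Q^\perp]=\beta/2$, $h^\perp_{1,0}=-h^\perp_{2,0}$, $Q_1^\perp=-Q_2^\perp$,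 all other commutators vanishing. They are realized in $\mathcal H$ by, for $n>0$, $$h^\perp_{1,n}=\tfrac{(1+q_1^n)(1+q_3^n)}{2(1+q_2^{-n})}a_n+\tfrac{\sqrt\beta}2(1-q_1^n)\widetilde a_n,\quad h^\perp_{1,-n}=a_{-n}+\tfrac{1-q_3^n}{\sqrt\beta(1+q_2^{-n})}\widetilde a_{-n},$$ $$h^\perp_{2,n}=-\tfrac{(1+q_1^n)(1+q_3^n)}{2(1+q_2^{-n})}a_n+\tfrac{\sqrt\beta}2(1-q_1^n)\widetilde a_n,\quad h^\perp_{2,-n}=-a_{-n}+\tfrac{1-q_3^n}{\sqrt\beta(1+q_2^{-n})}\widetilde a_{-n},$$ $h^\perp_{1,0}=-h^\perp_{2,0}=a_0$, $Q^\perp_1=-Q^\perp_2=Q$, $\mathsf a_0^\perp=\frac{\sqrt\beta}2\widetilde a_0$, $\mathsf Q^\perp=\sqrt\beta\,\widetilde Q$. The $\hbar$-expansion is the expansion, with $\beta$ fixed, of the normally ordered expressions in the generators of $\mathcal H$. *)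

theory Defs
  imports "HOL-Analysis.Analysis" "HOL-Library.Multiset" "HOL-Library.Function_Algebras"
begin

section \<open>The completed Heisenberg algebra\<close>

text \<open>\<open>A n\<close>, \<open>Q\<close>, \<open>At n\<close>, \<open>Qt\<close> stand for \<open>a\<^sub>n\<close>, \<open>Q\<close> and their tilded versions.\<close>

datatype gen = A int | Q | At int | Qt

fun comm :: "gen \<Rightarrow> gen \<Rightarrow> complex" where
  "comm (A n) (A m) = (if n + m = 0 then of_int n else 0)"
| "comm (At n) (At m) = (if n + m = 0 then of_int n else 0)"
| "comm (A n) Q = (if n = 0 then 1 else 0)"
| "comm Q (A n) = (if n = 0 then -1 else 0)"
| "comm (At n) Qt = (if n = 0 then 1 else 0)"
| "comm Qt (At n) = (if n = 0 then -1 else 0)"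
| "comm _ _ = 0"

fun annihilator :: "gen \<Rightarrow> bool" where
  "annihilator (A n) \<longleftrightarrow> n \<ge> 0"
| "annihilator Q \<longleftrightarrow> False"
| "annihilator (At n) \<longleftrightarrow> n \<ge> 0"
| "annihilator Qt \<longleftrightarrow> False"

text \<open>
  The normally ordered monomials, which correspond to finite multisets of generators, form a basis
  of the Heisenberg algebra. An element of its completion is a possibly infinite linear combination
  of them, given by its coefficients. All infinite sums below are coefficientwise, and where they
  are used they have only finitely many nonzero terms.
\<close>

type_synonym heis = "gen multiset \<Rightarrow> complex"

definition mon :: "gen multiset \<Rightarrow> heis" where
  "mon k = (\<lambda>m. if m = k then 1 else 0)"

abbreviation gen :: "gen \<Rightarrow> heis" where
  "gen g \<equiv> mon {#g#}"

definition smul :: "complex \<Rightarrow> heis \<Rightarrow> heis" (infixr "*\<^sub>H" 75) where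
  "c *\<^sub>H X = (\<lambda>m. c * X m)"

text \<open>
  Left multiplication by a generator \<open>g\<close>. If \<open>g\<close> is a creation operator, then \<open>g\<close> times a normally
  ordered monomial \<open>m\<close> is the monomial \<open>m + {#g#}\<close>. An annihilation operator has to be moved to the
  right of the creation operators of \<open>m\<close>, so that the commutators with the factors \<open>h\<close> of \<open>m\<close> are
  added.
\<close>

definition lmul :: "gen \<Rightarrow> heis \<Rightarrow> heis" where
  "lmul g X = (\<lambda>m. (if g \<in># m then X (m - {#g#}) else 0) +
     (if annihilator g
      then \<Sum>\<^sub>\<infinity>h\<in>UNIV. comm g h * of_nat (count m h + 1) * X (m + {#h#}) else 0))"

text \<open>Left multiplication by the normally ordered monomial \<open>k\<close>: its annihilation operators act first.\<close>

definition lmul_mon :: "gen multiset \<Rightarrow> heis \<Rightarrow> heis" where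
  "lmul_mon k X =
     fold_mset (\<lambda>g. if annihilator g then id else lmul g)
       (fold_mset (\<lambda>g. if annihilator g then lmul g else id) X k) k"

definition hprod :: "heis \<Rightarrow> heis \<Rightarrow> heis" (infixl "\<star>" 70) where
  "X \<star> Y = (\<lambda>m. \<Sum>\<^sub>\<infinity>k\<in>UNIV. X k * lmul_mon k Y m)"

text \<open>The normally ordered product \<open>:XY:\<close>, for which the generators commute with each other.\<close>

definition nprod :: "heis \<Rightarrow> heis \<Rightarrow> heis" where
  "nprod X Y = (\<lambda>m. \<Sum>k | k \<subseteq># m. X k * Y (m - k))"

primrec hpow :: "heis \<Rightarrow> nat \<Rightarrow> heis" where
  "hpow X 0 = mon {#}"
| "hpow X (Suc n) = X \<star> hpow X n"

primrec npow :: "heis \<Rightarrow> nat \<Rightarrow> heis" where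
  "npow X 0 = mon {#}"
| "npow X (Suc n) = nprod X (npow X n)"

text \<open>\<open>hexp X\<close> is \<open>e\<^sup>X\<close> and \<open>nexp X\<close> is \<open>:e\<^sup>X:\<close>.\<close>

definition hexp :: "heis \<Rightarrow> heis" where
  "hexp X = (\<lambda>m. \<Sum>\<^sub>\<infinity>n\<in>UNIV. hpow X n m / fact n)"

definition nexp :: "heis \<Rightarrow> heis" where
  "nexp X = (\<lambda>m. \<Sum>\<^sub>\<infinity>n\<in>UNIV. npow X n m / fact n)"

text \<open>The power \<open>c\<^sup>X\<close>.\<close>

definition hpowr :: "complex \<Rightarrow> heis \<Rightarrow> heis" where
  "hpowr c X = hexp (Ln c *\<^sub>H X)"

definition sum_nonzero_modes :: "(int \<Rightarrow> complex) \<Rightarrow> (int \<Rightarrow> heis) \<Rightarrow> heis" where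
  "sum_nonzero_modes c h = (\<lambda>m. \<Sum>\<^sub>\<infinity>n\<in>-{0}. c n * h n m)"

subsection \<open>The product satisfies the defining relations\<close>

fun partner :: "gen \<Rightarrow> gen" where
  "partner (A n) = (if n = 0 then Q else A (- n))"
| "partner (At n) = (if n = 0 then Qt else At (- n))"
| "partner Q = A 0"
| "partner Qt = At 0"

lemma comm_partner: "h \<noteq> partner g \<Longrightarrow> comm g h = 0"
  by (cases "(g, h)" rule: comm.cases) (auto split: if_splits)

lemma not_annihilator_partner: "annihilator g \<Longrightarrow> \<not> annihilator (partner g)"
  by (cases g) auto

lemma partner_partner: "partner (partner g) = g"
  by (cases g) auto

lemma comm_antisym: "comm h g = - comm g h"
  by (cases "(g, h)" rule: comm.cases) (auto simp: add_eq_0_iff)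

lemma comm_same_kind: "annihilator g = annihilator h \<Longrightarrow> comm g h = 0"
  by (cases "(g, h)" rule: comm.cases) (simp_all, linarith+)

lemma lmul_eq:
  "lmul g X m = (if g \<in># m then X (m - {#g#}) else 0) +
     (if annihilator g
      then comm g (partner g) * of_nat (count m (partner g) + 1) * X (m + {#partner g#}) else 0)"
proof -
  have "(\<Sum>\<^sub>\<infinity>h\<in>UNIV. comm g h * of_nat (count m h + 1) * X (m + {#h#})) =
        (\<Sum>\<^sub>\<infinity>h\<in>{partner g}. comm g h * of_nat (count m h + 1) * X (m + {#h#}))"
    by (rule infsum_cong_neutral) (auto simp: comm_partner)
  then show ?thesis
    by (simp add: lmul_def)
qed

definition shift :: "gen \<Rightarrow> heis \<Rightarrow> heis" where
  "shift g X = (\<lambda>m. if g \<in># m then X (m - {#g#}) else 0)"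

definition contract :: "gen \<Rightarrow> heis \<Rightarrow> heis" where
  "contract h X = (\<lambda>m. of_nat (count m h + 1) * X (m + {#h#}))"

lemma lmul_shift_contract:
  "lmul g X = shift g X +
     (if annihilator g then comm g (partner g) *\<^sub>H contract (partner g) X else 0)"
  by (auto simp: fun_eq_iff lmul_eq shift_def contract_def smul_def)

lemma shift_commute: "shift g (shift h X) = shift h (shift g X)"
proof
  fix m
  show "shift g (shift h X) m = shift h (shift g X) m"
  proof (cases "g = h")
    case False
    have "m - {#g#} - {#h#} = m - {#h#} - {#g#}"
      by (rule diff_right_commute)
    moreover have "h \<in># m - {#g#} \<longleftrightarrow> h \<in># m" "g \<in># m - {#h#} \<longleftrightarrow> g \<in># m"
      using False by (auto simp: in_diff_count)
    ultimately show ?thesis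
      by (simp add: shift_def)
  qed simp
qed

lemma contract_commute: "contract g (contract h X) = contract h (contract g X)"
proof (cases "g = h")
  case False
  have "X (m + {#h#} + {#g#}) = X (m + {#g#} + {#h#})" for m
    by (simp add: add_mset_commute)
  then show ?thesis
    using False by (simp add: fun_eq_iff contract_def add_mset_commute)
qed simp

lemma contract_shift:
  "contract h (shift g X) = shift g (contract h X) + (if g = h then X else 0)"
proof
  fix m
  show "contract h (shift g X) m = (shift g (contract h X) + (if g = h then X else 0)) m"
  proof (cases "g = h")
    case True
    then show ?thesis
      by (auto simp: contract_def shift_def algebra_simps not_in_iff of_nat_diff
          simp flip: count_greater_zero_iff)
  next
    case False
    then show ?thesis
      by (auto simp: contract_def shift_def)
  qed
qed

lemma shift_linear: "shift g (X + Y) = shift g X + shift g Y" "shift g (c *\<^sub>H X) = c *\<^sub>H shift g X"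
  by (auto simp: shift_def smul_def)

lemma contract_linear:
  "contract g (X + Y) = contract g X + contract g Y" "contract g (c *\<^sub>H X) = c *\<^sub>H contract g X"
  by (auto simp: contract_def smul_def algebra_simps)

theorem lmul_commutator: "lmul g (lmul h X) - lmul h (lmul g X) = comm g h *\<^sub>H X"
proof -
  have g: "g = partner h \<longleftrightarrow> h = partner g"
    using partner_partner by metis
  have "comm h g = - comm g h"
    by (rule comm_antisym)
  then show ?thesis
    using comm_same_kind[of g h] shift_commute[of g h X] contract_commute[of "partner g" "partner h" X]
      comm_partner[of h g] not_annihilator_partner[of g] not_annihilator_partner[of h]
    apply (cases "annihilator g"; cases "annihilator h"; cases "h = partner g")
    apply (simp_all add: lmul_shift_contract shift_linear contract_linear contract_shift
        partner_partner g)
    apply (auto simp: fun_eq_iff smul_def algebra_simps split: if_splits)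
    done
qed

lemma lmul_commute:
  assumes "annihilator g = annihilator h"
  shows "lmul g (lmul h X) = lmul h (lmul g X)"
proof -
  have "comm g h = 0"
    using assms by (rule comm_same_kind)
  then have "lmul g (lmul h X) - lmul h (lmul g X) = 0"
    by (simp add: lmul_commutator smul_def fun_eq_iff)
  then show ?thesis
    by simp
qed

lemma comp_fun_commute_lmul:
  "comp_fun_commute (\<lambda>g. if annihilator g then lmul g else id)"
  "comp_fun_commute (\<lambda>g. if annihilator g then id else lmul g)"
  by (unfold_locales; auto simp: fun_eq_iff lmul_commute; metis lmul_commute)+

lemma lmul_mon_single: "lmul_mon {#g#} X = lmul g X"
  by (simp add: lmul_mon_def comp_fun_commute.fold_mset_add_mset comp_fun_commute_lmul)

theorem gen_hprod: "gen g \<star> X = lmul g X"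
proof
  fix m
  have "(gen g \<star> X) m = (\<Sum>\<^sub>\<infinity>k\<in>{{#g#}}. gen g k * lmul_mon k X m)"
    unfolding hprod_def by (rule infsum_cong_neutral) (auto simp: mon_def)
  then show "(gen g \<star> X) m = lmul g X m"
    by (simp add: mon_def lmul_mon_single)
qed

lemma lmul_unit: "lmul g (mon {#}) = gen g"
proof
  fix m
  show "lmul g (mon {#}) m = gen g m"
    by (auto simp: lmul_eq mon_def)
       (metis insert_DiffM)+
qed

theorem heis_commutator: "gen g \<star> gen h - gen h \<star> gen g = comm g h *\<^sub>H mon {#}"
  by (metis gen_hprod lmul_commutator lmul_unit)


section \<open>Free fields\<close>

text \<open>
  A field is a function of a complex number \<open>z\<close> outside the branch cut of the logarithm. Up to
  constants, the coefficient of a normally ordered monomial in each field is an integral power of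
  \<open>z\<close> times a polynomial in \<open>log z\<close>.
\<close>

definition free_boson :: "gen \<Rightarrow> (int \<Rightarrow> gen) \<Rightarrow> complex \<Rightarrow> heis" where
  "free_boson q a z =
     gen q + Ln z *\<^sub>H gen (a 0) - sum_nonzero_modes (\<lambda>n. 1 / of_int n * z powi (- n)) (\<lambda>n. gen (a n))"

definition \<phi> :: "complex \<Rightarrow> heis" where
  "\<phi> = free_boson Q A"

definition \<phi>t :: "complex \<Rightarrow> heis" where
  "\<phi>t = free_boson Qt At"

definition field_deriv :: "(complex \<Rightarrow> heis) \<Rightarrow> complex \<Rightarrow> heis" where
  "field_deriv F z = (\<lambda>m. deriv (\<lambda>w. F w m) z)"

text \<open>Below, \<open>r2\<close>, \<open>rm2\<close> and \<open>r\<beta>\<close> are square roots of \<open>2\<close>, \<open>-2\<close> and \<open>\<beta>\<close>.\<close>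

definition \<psi> :: "complex \<Rightarrow> complex \<Rightarrow> heis" where
  "\<psi> rm2 z = (1 / rm2) *\<^sub>H (nexp (\<phi> z) - nexp (- \<phi> z))"

definition \<psi>t :: "complex \<Rightarrow> complex \<Rightarrow> heis" where
  "\<psi>t r2 z = (1 / r2) *\<^sub>H (nexp (\<phi> z) + nexp (- \<phi> z))"

text \<open>\<open>\<phi>t'\<close> is linear in the generators, so that \<open>:\<phi>t': = \<phi>t'\<close>.\<close>

definition G :: "complex \<Rightarrow> complex \<Rightarrow> complex \<Rightarrow> complex \<Rightarrow> heis" where
  "G \<beta> r\<beta> rm2 z =
     (let \<sigma> = (1 - \<beta>) / (2 * r\<beta>)
      in field_deriv \<phi>t z \<star> \<psi> rm2 z + (2 * \<sigma>) *\<^sub>H field_deriv (\<psi> rm2) z)"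

section \<open>The currents\<close>

text \<open>Below, \<open>hb\<close> is the expansion parameter \<open>\<hbar>\<close>.\<close>

definition q1 :: "complex \<Rightarrow> complex" where
  "q1 hb = exp hb"

definition q2 :: "complex \<Rightarrow> complex \<Rightarrow> complex" where
  "q2 \<beta> hb = exp ((\<beta> - 1) * hb)"

definition q3 :: "complex \<Rightarrow> complex \<Rightarrow> complex" where
  "q3 \<beta> hb = exp (- \<beta> * hb)"

definition q :: "complex \<Rightarrow> complex \<Rightarrow> complex" where
  "q \<beta> hb = exp ((\<beta> - 1) * hb / 2)"

text \<open>For \<open>n < 0\<close> the formulas for \<open>h\<^sub>i\<^sub>,\<^sub>-\<^sub>k\<close> with \<open>k = - n > 0\<close> are used.\<close>

definition h1_perp :: "complex \<Rightarrow> complex \<Rightarrow> complex \<Rightarrow> int \<Rightarrow> heis" where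
  "h1_perp \<beta> r\<beta> hb n =
     (if n > 0 then
        ((1 + q1 hb powi n) * (1 + q3 \<beta> hb powi n) / (2 * (1 + q2 \<beta> hb powi (- n)))) *\<^sub>H gen (A n)
        + (r\<beta> / 2 * (1 - q1 hb powi n)) *\<^sub>H gen (At n)
      else if n < 0 then
        (let k = - n in
          gen (A (- k))
          + ((1 - q3 \<beta> hb powi k) / (r\<beta> * (1 + q2 \<beta> hb powi (- k)))) *\<^sub>H gen (At (- k)))
      else gen (A 0))"

definition h2_perp :: "complex \<Rightarrow> complex \<Rightarrow> complex \<Rightarrow> int \<Rightarrow> heis" where
  "h2_perp \<beta> r\<beta> hb n =
     (if n > 0 then
        - (((1 + q1 hb powi n) * (1 + q3 \<beta> hb powi n) / (2 * (1 + q2 \<beta> hb powi (- n)))) *\<^sub>H gen (A n))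
        + (r\<beta> / 2 * (1 - q1 hb powi n)) *\<^sub>H gen (At n)
      else if n < 0 then
        (let k = - n in
          - gen (A (- k))
          + ((1 - q3 \<beta> hb powi k) / (r\<beta> * (1 + q2 \<beta> hb powi (- k)))) *\<^sub>H gen (At (- k)))
      else - gen (A 0))"

definition a0_perp :: "complex \<Rightarrow> heis" where
  "a0_perp r\<beta> = (r\<beta> / 2) *\<^sub>H gen (At 0)"

text \<open>
  The currents for given modes \<open>h n\<close> and a given \<open>Qi\<close>. The four factors are multiplied in the
  Heisenberg algebra.
\<close>

definition \<Lambda>_plus ::
    "complex \<Rightarrow> complex \<Rightarrow> complex \<Rightarrow> (int \<Rightarrow> heis) \<Rightarrow> heis \<Rightarrow> complex \<Rightarrow> heis" where
  "\<Lambda>_plus \<beta> r\<beta> hb h Qi z =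
     nexp (- sum_nonzero_modes (\<lambda>n. q \<beta> hb powi n / of_int n * z powi (- n)) h)
     \<star> hexp Qi \<star> hpowr (inverse (q \<beta> hb) * z) (h 0) \<star> hpowr (q1 hb) (a0_perp r\<beta>)"

definition \<Lambda>_minus ::
    "complex \<Rightarrow> complex \<Rightarrow> complex \<Rightarrow> (int \<Rightarrow> heis) \<Rightarrow> heis \<Rightarrow> complex \<Rightarrow> heis" where
  "\<Lambda>_minus \<beta> r\<beta> hb h Qi z =
     nexp (sum_nonzero_modes (\<lambda>n. q \<beta> hb powi (- n) / of_int n * z powi (- n)) h)
     \<star> hexp (- Qi) \<star> hpowr (q \<beta> hb * z) (- h 0) \<star> hpowr (q1 hb) (- a0_perp r\<beta>)"

definition W1 :: "complex \<Rightarrow> complex \<Rightarrow> complex \<Rightarrow> complex \<Rightarrow> heis" where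
  "W1 \<beta> r\<beta> hb z =
     \<Lambda>_plus \<beta> r\<beta> hb (h1_perp \<beta> r\<beta> hb) (gen Q) z + \<Lambda>_minus \<beta> r\<beta> hb (h1_perp \<beta> r\<beta> hb) (gen Q) z"

definition W2 :: "complex \<Rightarrow> complex \<Rightarrow> complex \<Rightarrow> complex \<Rightarrow> heis" where
  "W2 \<beta> r\<beta> hb z =
     \<Lambda>_plus \<beta> r\<beta> hb (h2_perp \<beta> r\<beta> hb) (- gen Q) z + \<Lambda>_minus \<beta> r\<beta> hb (h2_perp \<beta> r\<beta> hb) (- gen Q) z"

text \<open>
  \<open>F hb = X0 + X1 hb + O(hb\<^sup>2)\<close>: the coefficient of every normally ordered monomial is given near
  \<open>hb = 0\<close> by a convergent power series in \<open>hb\<close> that is congruent to the right hand side modulo \<open>hb\<^sup>2\<close>.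
\<close>

definition hbar_expansion :: "(complex \<Rightarrow> heis) \<Rightarrow> heis \<Rightarrow> heis \<Rightarrow> bool" where
  "hbar_expansion F X0 X1 \<longleftrightarrow>
     (\<forall>m. \<exists>R. (\<lambda>hb. F hb m) has_fps_expansion
        (fps_const (X0 m) + fps_const (X1 m) * fps_X + fps_X ^ 2 * R))"

end

theory Submission
  imports Defs "HOL-Complex_Analysis.Laurent_Convergence"
begin

text \<open>Each of the four terms \<open>\<Lambda>\<^sub>i\<^sup>\<plusminus>\<close> is the normally ordered exponential of an expression that is linear
in the generators, so that its dependence on \<open>\<hbar>\<close> is that of the coefficients of this expression.
Write \<open>t = \<plusminus>1\<close> for the sign of \<open>\<Lambda>\<^sub>i\<^sup>\<plusminus>\<close>, and \<open>s = 1\<close> for \<open>i = 1\<close>, \<open>s = -1\<close> for \<open>i = 2\<close>. As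
\<open>q\<^sub>1q\<^sub>2q\<^sub>3 = 1\<close>, the coefficient of \<open>a\<^sub>n\<close> in \<open>h\<^sup>\<bottom>\<^sub>i\<^sub>,\<^sub>n\<close> is \<open>s + O(\<hbar>\<^sup>2)\<close>, and because \<open>\<surd>\<beta>\<close> squares to \<open>\<beta>\<close>, the
coefficient of \<open>at\<^sub>n\<close> is \<open>-\<surd>\<beta> n \<hbar> / 2 + O(\<hbar>\<^sup>2)\<close> for positive and negative \<open>n\<close> alike.
Together with the expansions of \<open>q\<^sup>n\<close>, of \<open>(q\<^sup>-\<^sup>1z)\<^sup>h\<close> and of \<open>q\<^sub>1\<^sup>a\<close> for the zero modes, the modes
assemble to the exponent
  \<open>t s \<phi>(z) + \<hbar> (s (1 - \<beta>)/2 z \<phi>'(z) + t \<surd>\<beta>/2 z \<phi>t'(z)) + O(\<hbar>\<^sup>2)\<close>.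
The sum over \<open>t\<close> of the exponentials is \<open>:e\<^sup>\<phi>: + :e\<^sup>-\<^sup>\<phi>:\<close> at order \<open>0\<close>, and at order \<open>1\<close>
  \<open>s (1 - \<beta>)/2 z :\<phi>'(e\<^sup>\<phi> + e\<^sup>-\<^sup>\<phi>): + s \<surd>\<beta>/2 z :\<phi>t'(e\<^sup>\<phi> - e\<^sup>-\<^sup>\<phi>):\<close>.
Here the second summand is a multiple of \<open>:\<phi>t': \<psi>\<close>, and the first one is a multiple of \<open>\<psi>'\<close>; the
normalization of \<open>G\<close> and of \<open>\<sigma>\<close> is exactly the one that collects them to \<open>s \<surd>(-2\<beta>)/2 z G(z)\<close>.\<close>

text \<open>To make this rigorous coefficient by coefficient, note that the coefficient of a normally ordered
monomial \<open>m\<close> in \<open>:exp (\<Sum>\<^sub>g c\<^sub>g g):\<close> is the finite product of the \<open>c\<^sub>g\<^sup>k / k!\<close>, with \<open>k\<close> the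
multiplicity of \<open>g\<close> in \<open>m\<close> (\<open>nexp_linear_comb\<close>). Products of such exponentials in the algebra reduce to
the addition of their exponents whenever no contraction occurs (\<open>vertex_hprod_vertex\<close>), and
differentiation in a parameter is the Leibniz rule (\<open>vertex_has_field_derivative\<close>). This
gives the closed form of \<open>\<Lambda>\<^sub>i\<^sup>\<plusminus>\<close> for every \<open>\<hbar>\<close> (\<open>\<Lambda>_eq_vertex\<close>). The coefficients are analytic at
\<open>\<hbar> = 0\<close>, so that the first two terms of their power series are the value and the derivative there
(\<open>hbar_expansionI\<close>).\<close>

section \<open>Sums over submultisets\<close>

lemma infsum_single:
  fixes f :: "'a \<Rightarrow> complex"
  assumes "\<And>x. x \<in> S \<Longrightarrow> x \<noteq> a \<Longrightarrow> f x = 0"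
  shows "infsum f S = (if a \<in> S then f a else 0)"
proof -
  have "infsum f S = infsum f (S \<inter> {a})"
    by (rule infsum_cong_neutral) (use assms in auto)
  then show ?thesis
    by auto
qed

lemma count_eq_0_outside: "k \<subseteq># m \<Longrightarrow> g \<notin># m \<Longrightarrow> count k g = 0"
  by (meson mset_subset_eqD not_in_iff)

text \<open>A submultiset is determined by its multiplicities on the support, and these are bounded.\<close>

lemma finite_submultisets: "finite {k. k \<subseteq># m}"
proof (rule inj_on_finite)
  let ?B = "Pi\<^sub>E (set_mset m) (\<lambda>g. {..count m g})"
  show "inj_on (\<lambda>k. restrict (count k) (set_mset m)) {k. k \<subseteq># m}"
  proof (rule inj_onI)
    fix k l assume kl: "k \<in> {k. k \<subseteq># m}" "l \<in> {k. k \<subseteq># m}"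
      and eq: "restrict (count k) (set_mset m) = restrict (count l) (set_mset m)"
    show "k = l"
    proof (rule multiset_eqI)
      fix g
      show "count k g = count l g"
        using fun_cong[OF eq, of g] kl
        by (cases "g \<in># m") (auto simp: count_eq_0_outside)
    qed
  qed
  show "(\<lambda>k. restrict (count k) (set_mset m)) ` {k. k \<subseteq># m} \<subseteq> ?B"
    by (auto simp: subseteq_mset_def)
  show "finite ?B"
    by (intro finite_PiE) auto
qed

lemma count_sum_replicate:
  assumes "finite S"
  shows "count (\<Sum>g\<in>S. replicate_mset (f g) g) h = (if h \<in> S then f h else 0)"
  using assms by (induction S rule: finite_induct) auto

section \<open>Linear combinations of generators and their normally ordered exponentials\<close>

definition linear_comb :: "(gen \<Rightarrow> complex) \<Rightarrow> heis" where
  "linear_comb c = (\<lambda>m. \<Sum>g\<in>set_mset m. if m = {#g#} then c g else 0)"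

text \<open>The coefficients of \<open>:exp (\<Sum>\<^sub>g c\<^sub>g g):\<close>, as the multinomial theorem gives them for commuting
generators. The product is over the support of \<open>m\<close>, hence finite also when the linear combination has
infinitely many terms.\<close>

definition vertex :: "(gen \<Rightarrow> complex) \<Rightarrow> heis" where
  "vertex c = (\<lambda>m. \<Prod>g\<in>set_mset m. c g ^ count m g / fact (count m g))"

lemma linear_comb_single [simp]: "linear_comb c {#g#} = c g"
  by (simp add: linear_comb_def)

lemma linear_comb_eq_0: "(\<And>g. m \<noteq> {#g#}) \<Longrightarrow> linear_comb c m = 0"
  by (simp add: linear_comb_def)

lemma linear_comb_eqI:
  assumes "\<And>g. X {#g#} = c g" and "\<And>m. (\<And>g. m \<noteq> {#g#}) \<Longrightarrow> X m = 0"
  shows "X = linear_comb c"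
proof
  fix m
  show "X m = linear_comb c m"
    by (cases "\<exists>g. m = {#g#}") (use assms in \<open>auto simp: linear_comb_eq_0\<close>)
qed

lemma linear_comb_arith:
  "linear_comb c + linear_comb d = linear_comb (\<lambda>g. c g + d g)"
  "linear_comb c - linear_comb d = linear_comb (\<lambda>g. c g - d g)"
  "- linear_comb c = linear_comb (\<lambda>g. - c g)"
  "a *\<^sub>H linear_comb c = linear_comb (\<lambda>g. a * c g)"
  by (rule linear_comb_eqI; simp add: linear_comb_eq_0 smul_def)+

lemma gen_eq_linear_comb: "gen g = linear_comb (\<lambda>h. if h = g then 1 else 0)"
  by (rule linear_comb_eqI) (auto simp: mon_def)

lemma smul_gen: "c *\<^sub>H gen g = linear_comb (\<lambda>h. if h = g then c else 0)"
  by (rule linear_comb_eqI) (auto simp: smul_def mon_def)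

lemma smul_smul: "a *\<^sub>H b *\<^sub>H X = (a * b) *\<^sub>H X"
  by (simp add: smul_def mult.assoc)

lemma smul_minus: "- (a *\<^sub>H X) = (- a) *\<^sub>H X"
  by (simp add: smul_def fun_eq_iff)

lemma smul_1: "1 *\<^sub>H X = X" "(- 1) *\<^sub>H X = - X"
  by (simp_all add: smul_def fun_eq_iff)

lemma vertex_superset:
  assumes "finite S" and "set_mset m \<subseteq> S"
  shows "vertex c m = (\<Prod>g\<in>S. c g ^ count m g / fact (count m g))"
  unfolding vertex_def
  by (rule prod.mono_neutral_left) (use assms in \<open>auto simp flip: count_eq_zero_iff\<close>)

lemma vertex_eq_0: "g \<in># m \<Longrightarrow> c g = 0 \<Longrightarrow> vertex c m = 0"
  unfolding vertex_def by (rule prod_zero) (auto intro!: bexI[of _ g])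

lemma vertex_diff_single:
  assumes "g \<in># m"
  shows "vertex c (m - {#g#}) =
    c g ^ (count m g - 1) / fact (count m g - 1) *
      (\<Prod>h\<in>set_mset m - {g}. c h ^ count m h / fact (count m h))"
proof -
  have "vertex c (m - {#g#}) = (\<Prod>h\<in>set_mset m.
      c h ^ count (m - {#g#}) h / fact (count (m - {#g#}) h))"
    by (rule vertex_superset) (auto dest: in_diffD)
  also have "\<dots> = c g ^ (count m g - 1) / fact (count m g - 1) *
      (\<Prod>h\<in>set_mset m - {g}. c h ^ count (m - {#g#}) h / fact (count (m - {#g#}) h))"
    using assms by (subst prod.remove[of _ g]) auto
  also have "(\<Prod>h\<in>set_mset m - {g}. c h ^ count (m - {#g#}) h / fact (count (m - {#g#}) h)) =
      (\<Prod>h\<in>set_mset m - {g}. c h ^ count m h / fact (count m h))"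
    by (rule prod.cong) auto
  finally show ?thesis
    by simp
qed

text \<open>Removing one factor \<open>g\<close> from a monomial; summed over \<open>g\<close> this is the Euler identity that carries the
induction for the powers of a linear combination.\<close>

lemma vertex_recursion:
  assumes "g \<in># m"
  shows "c g * vertex c (m - {#g#}) = of_nat (count m g) * vertex c m"
proof -
  obtain n where n: "count m g = Suc n"
    using assms by (metis count_greater_zero_iff gr0_conv_Suc)
  have "vertex c m = c g ^ count m g / fact (count m g) *
      (\<Prod>h\<in>set_mset m - {g}. c h ^ count m h / fact (count m h))"
    using assms unfolding vertex_def by (subst prod.remove[of _ g]) auto
  then show ?thesis
    using n assms by (simp add: vertex_diff_single field_simps del: of_nat_Suc)
qed

lemma nprod_linear:
  "nprod (X + Y) Z m = nprod X Z m + nprod Y Z m"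
  "nprod (a *\<^sub>H X) Z m = a * nprod X Z m"
  "nprod X (Y - Z) m = nprod X Y m - nprod X Z m"
  "nprod X (a *\<^sub>H Y) m = a * nprod X Y m"
  by (simp_all add: nprod_def smul_def algebra_simps sum.distrib sum_subtractf sum_distrib_left)

text \<open>A linear combination is supported on the monomials with one factor, so that only the removal of a
single generator contributes to the product.\<close>

lemma nprod_linear_comb:
  "nprod (linear_comb c) Y m = (\<Sum>g\<in>set_mset m. c g * Y (m - {#g#}))"
proof -
  have "nprod (linear_comb c) Y m =
      (\<Sum>k\<in>(\<lambda>g. {#g#}) ` set_mset m. linear_comb c k * Y (m - k))"
    unfolding nprod_def
    by (rule sum.mono_neutral_right) (auto simp: finite_submultisets intro!: linear_comb_eq_0)
  also have "\<dots> = (\<Sum>g\<in>set_mset m. c g * Y (m - {#g#}))"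
    by (subst sum.reindex) (auto simp: inj_on_def)
  finally show ?thesis .
qed

lemma npow_linear_comb:
  "npow (linear_comb c) n m = (if size m = n then fact n * vertex c m else 0)"
proof (induction n arbitrary: m)
  case 0
  then show ?case
    by (auto simp: mon_def vertex_def)
next
  case (Suc n)
  have "npow (linear_comb c) (Suc n) m =
      (\<Sum>g\<in>set_mset m. c g * npow (linear_comb c) n (m - {#g#}))"
    by (simp add: nprod_linear_comb)
  also have "\<dots> = (\<Sum>g\<in>set_mset m.
      if size m = Suc n then fact n * (of_nat (count m g) * vertex c m) else 0)"
  proof (rule sum.cong)
    fix g assume g: "g \<in> set_mset m"
    then have "size (m - {#g#}) = n \<longleftrightarrow> size m = Suc n"
      by (metis size_Suc_Diff1 nat.inject)
    with vertex_recursion[OF g, of c] show "c g * npow (linear_comb c) n (m - {#g#}) =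
      (if size m = Suc n then fact n * (of_nat (count m g) * vertex c m) else 0)"
      by (simp add: Suc.IH mult.left_commute)
  qed simp
  also have "\<dots> = (if size m = Suc n then fact n * of_nat (size m) * vertex c m else 0)"
    by (auto simp: size_multiset_overloaded_eq mult.assoc
        simp flip: sum_distrib_left sum_distrib_right of_nat_sum)
  finally show ?case
    by (auto simp: algebra_simps)
qed

text \<open>Only the power whose exponent is the degree of the monomial contributes.\<close>

lemma nexp_linear_comb: "nexp (linear_comb c) = vertex c"
proof
  fix m
  show "nexp (linear_comb c) m = vertex c m"
    unfolding nexp_def by (subst infsum_single[where a = "size m"]) (auto simp: npow_linear_comb)
qed

section \<open>Products without contractions\<close>

text \<open>Moving an annihilation operator \<open>g\<close> to its place in a monomial costs one contraction for each
occurrence of its partner. If the partner does not occur in \<open>Y\<close>, then \<open>g\<close> acts by mere insertion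
into the monomials, as a creation operator does.\<close>

lemma lmul_mon_no_contraction:
  assumes "\<And>g m. g \<in># k \<Longrightarrow> annihilator g \<Longrightarrow> Y (m + {#partner g#}) = 0"
  shows "lmul_mon k Y m = (if k \<subseteq># m then Y (m - k) else 0)"
proof -
  define Z where "Z j = (\<lambda>m. if j \<subseteq># m then Y (m - j) else 0)" for j
  have step: "shift g (Z j) = Z (add_mset g j)" for g j
    by (auto simp: Z_def shift_def fun_eq_iff insert_subset_eq_iff)
  have Z_0: "Z {#} = Y"
    by (simp add: Z_def)
  interpret ann: comp_fun_commute "\<lambda>g. if annihilator g then lmul g else id"
    by (rule comp_fun_commute_lmul)
  interpret cre: comp_fun_commute "\<lambda>g. if annihilator g then id else lmul g"
    by (rule comp_fun_commute_lmul)
  have ann: "fold_mset (\<lambda>g. if annihilator g then lmul g else id) Y k =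
      Z (filter_mset annihilator k)"
    using assms
  proof (induction k)
    case (add g k)
    show ?case
    proof (cases "annihilator g")
      case True
      have "contract (partner g) (Z (filter_mset annihilator k)) = (\<lambda>_. 0)"
      proof
        fix m
        have "Y (m + {#partner g#} - filter_mset annihilator k) = 0"
          if "filter_mset annihilator k \<subseteq># m + {#partner g#}"
        proof -
          have "partner g \<notin># filter_mset annihilator k"
            using not_annihilator_partner[OF True] by simp
          then have "m + {#partner g#} - filter_mset annihilator k =
              (m - filter_mset annihilator k) + {#partner g#}"
            by simp
          then show ?thesis
            using add.prems[of g] True by simp
        qed
        then show "contract (partner g) (Z (filter_mset annihilator k)) m = 0"
          by (simp add: contract_def Z_def)
      qed
      then have "lmul g (Z (filter_mset annihilator k)) = shift g (Z (filter_mset annihilator k))"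
        by (simp add: lmul_shift_contract smul_def fun_eq_iff)
      then show ?thesis
        using add True by (simp add: step)
    qed (use add in simp)
  qed (simp add: Z_0)
  have "fold_mset (\<lambda>g. if annihilator g then id else lmul g) (Z j) k =
      Z (filter_mset (\<lambda>g. \<not> annihilator g) k + j)" for j
    by (induction k) (simp_all add: lmul_shift_contract step)
  then show ?thesis
    \<comment> \<open>The annihilation operators of \<open>k\<close> have been inserted first; the rest of \<open>k\<close> completes them.\<close>
    unfolding lmul_mon_def ann by (simp add: union_ac Z_def flip: multiset_partition)
qed

lemma hprod_eq_nprod:
  assumes "\<And>k g m. X k \<noteq> 0 \<Longrightarrow> g \<in># k \<Longrightarrow> annihilator g \<Longrightarrow> Y (m + {#partner g#}) = 0"
  shows "X \<star> Y = nprod X Y"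
proof
  fix m
  have "(X \<star> Y) m = (\<Sum>\<^sub>\<infinity>k\<in>{k. k \<subseteq># m}. X k * Y (m - k))"
    unfolding hprod_def
  proof (rule infsum_cong_neutral)
    fix k
    have *: "X k * lmul_mon k Y m = X k * (if k \<subseteq># m then Y (m - k) else 0)"
      using assms lmul_mon_no_contraction[of k Y m] by (cases "X k = 0") auto
    show "k \<in> UNIV - {k. k \<subseteq># m} \<Longrightarrow> X k * lmul_mon k Y m = 0"
      and "k \<in> UNIV \<inter> {k. k \<subseteq># m} \<Longrightarrow> X k * lmul_mon k Y m = X k * Y (m - k)"
      using * by auto
  qed auto
  then show "(X \<star> Y) m = nprod X Y m"
    by (simp add: nprod_def finite_submultisets)
qed

text \<open>A generator commutes with itself, so that its powers are normally ordered.\<close>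

lemma hexp_smul_gen: "hexp (c *\<^sub>H gen g) = vertex (\<lambda>h. if h = g then c else 0)"
proof -
  have g: "partner g \<noteq> g"
    by (cases g) auto
  have "hpow (c *\<^sub>H gen g) n = npow (c *\<^sub>H gen g) n" for n
  proof (induction n)
    case (Suc n)
    have "c *\<^sub>H gen g \<star> npow (c *\<^sub>H gen g) n = nprod (c *\<^sub>H gen g) (npow (c *\<^sub>H gen g) n)"
    proof (rule hprod_eq_nprod)
      fix k h m assume *: "(c *\<^sub>H gen g) k \<noteq> 0" "h \<in># k"
      then have "h = g"
        by (auto simp: smul_def mon_def split: if_splits)
      then show "npow (c *\<^sub>H gen g) n (m + {#partner h#}) = 0"
        using g by (auto simp: smul_gen npow_linear_comb intro!: vertex_eq_0[of "partner g"])
    qed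
    then show ?case
      by (simp add: Suc)
  qed simp
  then show ?thesis
    unfolding hexp_def by (simp flip: nexp_linear_comb smul_gen add: nexp_def)
qed

text \<open>The exponential law. The generators commute under normal ordering, so that it is the
binomial theorem for each generator in the support of \<open>m\<close>; a choice of one summand for each
generator is a submultiset of \<open>m\<close>.\<close>

lemma nprod_vertex: "nprod (vertex c) (vertex d) = vertex (\<lambda>g. c g + d g)"
proof
  fix m :: "gen multiset"
  let ?S = "set_mset m"
  let ?t = "\<lambda>g j. c g ^ j / fact j * (d g ^ (count m g - j) / fact (count m g - j))"
  have binomial: "(c g + d g) ^ n / fact n =
      (\<Sum>j\<le>n. c g ^ j / fact j * (d g ^ (n - j) / fact (n - j)))" for g n
    by (auto simp: binomial_ring binomial_fact sum_divide_distrib intro!: sum.cong)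
  have "vertex (\<lambda>g. c g + d g) m = (\<Prod>g\<in>?S. \<Sum>j\<le>count m g. ?t g j)"
    by (simp add: vertex_def binomial)
  also have "\<dots> = (\<Sum>f\<in>Pi\<^sub>E ?S (\<lambda>g. {..count m g}). \<Prod>g\<in>?S. ?t g (f g))"
    by (rule prod_sum_PiE) auto
  also have "\<dots> = (\<Sum>k | k \<subseteq># m. vertex c k * vertex d (m - k))"
  proof (rule sum.reindex_bij_witness[where
        j = "\<lambda>f. \<Sum>g\<in>?S. replicate_mset (f g) g"
        and i = "\<lambda>k. restrict (count k) ?S"])
    fix f assume f: "f \<in> Pi\<^sub>E ?S (\<lambda>g. {..count m g})"
    let ?k = "\<Sum>g\<in>?S. replicate_mset (f g) g"
    have count: "count ?k h = (if h \<in> ?S then f h else 0)" for h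
      by (simp add: count_sum_replicate)
    show "restrict (count ?k) ?S = f"
      using f by (auto simp: count fun_eq_iff PiE_def extensional_def)
    show "?k \<in> {k. k \<subseteq># m}"
      using f by (auto simp: count subseteq_mset_def PiE_def Pi_def)
    have "set_mset ?k \<subseteq> ?S"
      using count by (intro subsetI) (metis count_eq_zero_iff)
    then have "vertex c ?k = (\<Prod>g\<in>?S. c g ^ f g / fact (f g))"
      by (subst vertex_superset[of ?S]) (auto simp: count intro!: prod.cong)
    moreover have "vertex d (m - ?k) =
        (\<Prod>g\<in>?S. d g ^ (count m g - f g) / fact (count m g - f g))"
      by (subst vertex_superset[of ?S]) (auto simp: count dest: in_diffD intro!: prod.cong)
    ultimately show "vertex c ?k * vertex d (m - ?k) = (\<Prod>g\<in>?S. ?t g (f g))"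
      by (simp only: prod.distrib)
  next
    fix k assume k: "k \<in> {k. k \<subseteq># m}"
    show "restrict (count k) ?S \<in> Pi\<^sub>E ?S (\<lambda>g. {..count m g})"
      using k by (auto simp: mset_subset_eq_count)
    show "(\<Sum>g\<in>?S. replicate_mset (restrict (count k) ?S g) g) = k"
      using k
      by (intro multiset_eqI) (subst count_sum_replicate, auto simp: count_eq_0_outside)
  qed
  finally show "nprod (vertex c) (vertex d) m = vertex (\<lambda>g. c g + d g) m"
    by (simp add: nprod_def)
qed

lemma vertex_hprod_vertex:
  assumes "\<And>g. annihilator g \<Longrightarrow> c g \<noteq> 0 \<Longrightarrow> d (partner g) = 0"
  shows "vertex c \<star> vertex d = vertex (\<lambda>g. c g + d g)"
  unfolding nprod_vertex[symmetric]
proof (rule hprod_eq_nprod)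
  fix k g m assume "vertex c k \<noteq> 0" and g: "g \<in># k" "annihilator g"
  then have "c g \<noteq> 0"
    using vertex_eq_0 by blast
  with g assms show "vertex d (m + {#partner g#}) = 0"
    by (intro vertex_eq_0[of "partner g"]) auto
qed

section \<open>Dependence on a parameter\<close>

text \<open>The chain rule \<open>(:e\<^sup>X:)' = :X' e\<^sup>X:\<close>, valid because only finitely many coefficients of \<open>X\<close> enter the
coefficient of a given monomial. It serves for the derivative in \<open>z\<close> as well as for the one
in \<open>\<hbar>\<close>.\<close>

lemma vertex_has_field_derivative:
  assumes "\<And>g. g \<in># m \<Longrightarrow> ((\<lambda>x. c x g) has_field_derivative c' g) (at x)"
  shows "((\<lambda>x. vertex (c x) m) has_field_derivative nprod (linear_comb c') (vertex (c x)) m) (at x)"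
proof -
  let ?S = "set_mset m"
  let ?f = "\<lambda>g x. c x g ^ count m g / fact (count m g)"
  have factor: "(?f g has_derivative
      (\<lambda>y. c' g * (c x g ^ (count m g - 1) / fact (count m g - 1)) * y)) (at x)"
    if g: "g \<in># m" for g
  proof -
    obtain n where n: "count m g = Suc n"
      using g by (metis count_greater_zero_iff gr0_conv_Suc)
    have "(?f g has_field_derivative
        c' g * (c x g ^ (count m g - 1) / fact (count m g - 1))) (at x)"
      using DERIV_cdivide[OF DERIV_power[OF assms[OF g], of "count m g"], of "fact (count m g)"]
      by (rule DERIV_cong) (simp add: n field_simps del: of_nat_Suc)
    then show ?thesis
      by (simp only: has_field_derivative_def)
  qed
  have "((\<lambda>x. \<Prod>g\<in>?S. ?f g x) has_derivative
      (\<lambda>y. \<Sum>g\<in>?S. c' g * (c x g ^ (count m g - 1) / fact (count m g - 1)) * y *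
        (\<Prod>h\<in>?S - {g}. ?f h x))) (at x)"
    by (rule has_derivative_prod) (rule factor)
  moreover have "(\<lambda>y. \<Sum>g\<in>?S. c' g * (c x g ^ (count m g - 1) / fact (count m g - 1)) * y *
        (\<Prod>h\<in>?S - {g}. ?f h x)) = (*) (nprod (linear_comb c') (vertex (c x)) m)"
    unfolding nprod_linear_comb sum_distrib_right
    by (intro ext sum.cong) (simp_all add: vertex_diff_single)
  ultimately show ?thesis
    unfolding has_field_derivative_def vertex_def[of "c _"] by (simp only:)
qed

lemma vertex_analytic:
  assumes "\<And>g. (\<lambda>x. c x g) analytic_on S"
  shows "(\<lambda>x. vertex (c x) m) analytic_on S"
  unfolding vertex_def by (intro analytic_intros assms) auto

lemma linear_comb_has_field_derivative:
  assumes "\<And>g. ((\<lambda>x. c x g) has_field_derivative c' g) (at x)"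
  shows "((\<lambda>x. linear_comb (c x) m) has_field_derivative linear_comb c' m) (at x)"
  by (cases "\<exists>g. m = {#g#}") (use assms in \<open>auto simp: linear_comb_eq_0\<close>)

text \<open>By Taylor expansion; the remainder \<open>R\<close> is the power series shifted by two places.\<close>

lemma hbar_expansionI:
  assumes "\<And>m. (\<lambda>hb. F hb m) analytic_on {0}"
    and "\<And>m. F 0 m = X0 m"
    and "\<And>m. ((\<lambda>hb. F hb m) has_field_derivative X1 m) (at 0)"
  shows "hbar_expansion F X0 X1"
  unfolding hbar_expansion_def
proof
  fix m
  let ?f = "\<lambda>hb. F hb m"
  obtain P where P: "?f has_fps_expansion P"
    using analytic_at_imp_has_fps_expansion_0[OF assms(1)] by blast
  have "fps_nth P 0 = X0 m" "fps_nth P 1 = X1 m"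
    using fps_nth_fps_expansion[OF P, of 0] fps_nth_fps_expansion[OF P, of 1]
      DERIV_imp_deriv[OF assms(3)] by (simp_all add: assms(2))
  then have coeffs: "fps_nth P n =
      fps_nth (fps_const (X0 m) + fps_const (X1 m) * fps_X + fps_X ^ 2 * fps_shift 2 P) n" for n
    by (cases "n < 2") (auto simp: fps_X_power_mult_nth less_2_cases_iff simp flip: add_2_eq_Suc')
  have "P = fps_const (X0 m) + fps_const (X1 m) * fps_X + fps_X ^ 2 * fps_shift 2 P"
    by (rule fps_ext) (rule coeffs)
  with P show "\<exists>R. ?f has_fps_expansion
      fps_const (X0 m) + fps_const (X1 m) * fps_X + fps_X ^ 2 * R"
    by metis
qed

section \<open>The free bosons and fermions\<close>

text \<open>The index of a mode. The generators \<open>Q\<close> and \<open>Qt\<close> count as zero modes, so that the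
generators in a sum over the nonzero modes are those with \<open>mode g \<noteq> 0\<close>.\<close>

fun mode :: "gen \<Rightarrow> int" where
  "mode (A n) = n"
| "mode (At n) = n"
| "mode Q = 0"
| "mode Qt = 0"

text \<open>Since \<open>h n\<close> only involves generators of mode \<open>n\<close>, a single summand contributes to the coefficient of
each generator.\<close>

lemma sum_nonzero_modes_linear_comb:
  assumes h: "\<And>n. n \<noteq> 0 \<Longrightarrow> h n = linear_comb (d n)"
    and d: "\<And>n g. n \<noteq> 0 \<Longrightarrow> d n g \<noteq> 0 \<Longrightarrow> mode g = n"
  shows "sum_nonzero_modes c h =
    linear_comb (\<lambda>g. if mode g = 0 then 0 else c (mode g) * d (mode g) g)"
proof (rule linear_comb_eqI)
  fix g
  show "sum_nonzero_modes c h {#g#} = (if mode g = 0 then 0 else c (mode g) * d (mode g) g)"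
    unfolding sum_nonzero_modes_def
    by (subst infsum_single[where a = "mode g"]) (use d in \<open>auto simp: h\<close>)
next
  fix m :: "gen multiset" assume "\<And>g. m \<noteq> {#g#}"
  then show "sum_nonzero_modes c h m = 0"
    unfolding sum_nonzero_modes_def by (intro infsum_0) (auto simp: h linear_comb_eq_0)
qed

text \<open>The coefficients of the free boson with constant term \<open>p\<close> and modes \<open>a n\<close>. For \<open>a = A\<close> and
\<open>a = At\<close>, the condition \<open>g = a (mode g)\<close> says that \<open>g\<close> is one of the modes \<open>a n\<close>.\<close>

definition boson_coeff :: "gen \<Rightarrow> (int \<Rightarrow> gen) \<Rightarrow> complex \<Rightarrow> gen \<Rightarrow> complex" where
  "boson_coeff p a z g =
     (if g = p then 1 else if g = a 0 then Ln z
      else if g = a (mode g) then - (z powi (- mode g) / of_int (mode g)) else 0)"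

text \<open>The coefficients of the derivative of the free boson, \<open>\<Sum>\<^sub>n a\<^sub>n z\<^sup>-\<^sup>n\<^sup>-\<^sup>1\<close>.\<close>

definition current_coeff :: "(int \<Rightarrow> gen) \<Rightarrow> complex \<Rightarrow> gen \<Rightarrow> complex" where
  "current_coeff a z g = (if g = a (mode g) then z powi (- mode g - 1) else 0)"

lemma free_boson_eq:
  assumes "\<And>n. mode (a n) = n" and "\<And>n. a n \<noteq> p"
  shows "free_boson p a z = linear_comb (boson_coeff p a z)"
proof -
  let ?d = "\<lambda>n g. if g = a n then 1 else 0"
  have modes: "sum_nonzero_modes (\<lambda>n. 1 / of_int n * z powi (- n)) (\<lambda>n. gen (a n)) =
      linear_comb (\<lambda>g. if mode g = 0 then 0
        else 1 / of_int (mode g) * z powi (- mode g) * ?d (mode g) g)"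
    by (rule sum_nonzero_modes_linear_comb) (auto simp: gen_eq_linear_comb assms split: if_splits)
  show ?thesis
    unfolding free_boson_def modes
    unfolding gen_eq_linear_comb linear_comb_arith
  proof (intro arg_cong[of _ _ linear_comb] ext)
    fix g
    have "a (mode g) \<noteq> p" and "mode (a 0) = 0"
      using assms by auto
    then show "(if g = p then 1 else 0) + Ln z * ?d 0 g -
        (if mode g = 0 then 0 else 1 / of_int (mode g) * z powi (- mode g) * ?d (mode g) g) =
        boson_coeff p a z g"
      using assms(2)[of 0] by (cases "g = a 0"; cases "g = p") (auto simp: boson_coeff_def)
  qed
qed

text \<open>The derivative of the logarithm supplies the term \<open>n = 0\<close>, which has the same form as the others.\<close>

lemma boson_coeff_has_field_derivative:
  assumes "\<And>n. mode (a n) = n" and "\<And>n. a n \<noteq> p" and z: "z \<notin> \<real>\<^sub>\<le>\<^sub>0"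
  shows "((\<lambda>z. boson_coeff p a z g) has_field_derivative current_coeff a z g) (at z)"
proof -
  have [simp]: "z \<noteq> 0"
    using z by auto
  consider "g = p" | "g = a 0" | "g \<noteq> p" "g \<noteq> a 0" "g = a (mode g)" | "g \<noteq> p" "g \<noteq> a (mode g)"
    by metis
  then show ?thesis
  proof cases
    case 1
    then show ?thesis
      using assms(2)[of "mode p"] by (simp add: boson_coeff_def current_coeff_def)
  next
    case 2
    then show ?thesis
      using z assms(2)[of 0] assms(1)
      by (auto simp: boson_coeff_def current_coeff_def power_int_minus field_simps
          intro!: derivative_eq_intros)
  next
    case 3
    then have "mode g \<noteq> 0" by auto
    have "((\<lambda>z. - (z powi (- mode g) / of_int (mode g))) has_field_derivative
        z powi (- mode g - 1)) (at z)"
      using \<open>mode g \<noteq> 0\<close> by (auto intro!: derivative_eq_intros)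
    with 3 show ?thesis
      by (simp add: boson_coeff_def current_coeff_def)
  next
    case 4
    then have "g \<noteq> a 0"
      using assms(1) by metis
    with 4 show ?thesis
      by (simp add: boson_coeff_def current_coeff_def)
  qed
qed

lemma \<phi>_eq: "\<phi> z = linear_comb (boson_coeff Q A z)"
  unfolding \<phi>_def by (rule free_boson_eq) auto

lemma field_deriv_\<phi>t:
  assumes "z \<notin> \<real>\<^sub>\<le>\<^sub>0"
  shows "field_deriv \<phi>t z = linear_comb (current_coeff At z)"
proof -
  have "\<phi>t = (\<lambda>z. linear_comb (boson_coeff Qt At z))"
    unfolding \<phi>t_def by (intro ext free_boson_eq) auto
  show ?thesis
    unfolding field_deriv_def \<open>\<phi>t = _\<close>
    by (auto intro!: ext DERIV_imp_deriv linear_comb_has_field_derivative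
        boson_coeff_has_field_derivative assms)
qed

text \<open>The vertex operator \<open>:e\<^sup>\<epsilon>\<^sup>\<phi>\<^sup>(\<^sup>z\<^sup>):\<close>.\<close>

definition vertex_op :: "complex \<Rightarrow> complex \<Rightarrow> heis" where
  "vertex_op \<epsilon> z = vertex (\<lambda>g. \<epsilon> * boson_coeff Q A z g)"

lemma nexp_\<phi>: "nexp (\<phi> z) = vertex_op 1 z" "nexp (- \<phi> z) = vertex_op (- 1) z"
  by (simp_all add: \<phi>_eq nexp_linear_comb linear_comb_arith vertex_op_def)

lemma vertex_op_has_field_derivative:
  assumes "z \<notin> \<real>\<^sub>\<le>\<^sub>0"
  shows "((\<lambda>z. vertex_op \<epsilon> z m) has_field_derivative
    \<epsilon> * nprod (linear_comb (current_coeff A z)) (vertex_op \<epsilon> z) m) (at z)"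
proof -
  have "((\<lambda>z. vertex_op \<epsilon> z m) has_field_derivative
      nprod (linear_comb (\<lambda>g. \<epsilon> * current_coeff A z g)) (vertex_op \<epsilon> z) m) (at z)"
    unfolding vertex_op_def
    by (intro vertex_has_field_derivative DERIV_cmult boson_coeff_has_field_derivative assms) auto
  then show ?thesis
    by (simp add: nprod_linear flip: linear_comb_arith)
qed

lemma field_deriv_\<psi>:
  assumes "z \<notin> \<real>\<^sub>\<le>\<^sub>0"
  shows "field_deriv (\<psi> rm2) z m = 1 / rm2 *
    (nprod (linear_comb (current_coeff A z)) (vertex_op 1 z) m +
     nprod (linear_comb (current_coeff A z)) (vertex_op (- 1) z) m)"
  unfolding field_deriv_def \<psi>_def smul_def nexp_\<phi> minus_apply
  by (rule DERIV_imp_deriv)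
     (rule DERIV_cong[OF DERIV_cmult[OF DERIV_diff[OF
        vertex_op_has_field_derivative[OF assms] vertex_op_has_field_derivative[OF assms]]]], simp)

text \<open>The modes of \<open>\<phi>t'\<close> commute with those of \<open>\<phi>\<close>, of which \<open>\<psi>\<close> is composed, so that no contraction arises.\<close>

lemma hprod_\<psi>:
  "linear_comb (current_coeff At z) \<star> \<psi> rm2 z = nprod (linear_comb (current_coeff At z)) (\<psi> rm2 z)"
proof (rule hprod_eq_nprod)
  fix k g m
  assume k: "linear_comb (current_coeff At z) k \<noteq> 0" "g \<in># k"
  then obtain h where "k = {#h#}"
    using linear_comb_eq_0[of k] by blast
  with k have "current_coeff At z g \<noteq> 0"
    by simp
  then obtain n where "g = At n"
    by (cases g) (auto simp: current_coeff_def)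
  then have "boson_coeff Q A z (partner g) = 0"
    by (auto simp: boson_coeff_def)
  then have "vertex_op \<epsilon> z (m + {#partner g#}) = 0" for \<epsilon>
    unfolding vertex_op_def by (intro vertex_eq_0[of "partner g"]) auto
  then show "\<psi> rm2 z (m + {#partner g#}) = 0"
    by (simp add: \<psi>_def nexp_\<phi> smul_def)
qed

text \<open>\<open>G\<close> in terms of the normally ordered products of \<open>\<phi>'\<close> and \<open>\<phi>t'\<close> with \<open>:e\<^sup>\<plusminus>\<^sup>\<phi>:\<close>. Differentiating
\<open>e\<^sup>-\<^sup>\<phi>\<close> changes the sign, which turns the difference in \<open>\<psi>\<close> into a sum.\<close>

lemma G_eq:
  assumes "z \<notin> \<real>\<^sub>\<le>\<^sub>0"
  shows "G \<beta> r\<beta> rm2 z m = 1 / rm2 *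
    (nprod (linear_comb (current_coeff At z)) (vertex_op 1 z) m -
     nprod (linear_comb (current_coeff At z)) (vertex_op (- 1) z) m +
     (1 - \<beta>) / r\<beta> *
      (nprod (linear_comb (current_coeff A z)) (vertex_op 1 z) m +
       nprod (linear_comb (current_coeff A z)) (vertex_op (- 1) z) m))"
proof -
  have "G \<beta> r\<beta> rm2 z m = nprod (linear_comb (current_coeff At z)) (\<psi> rm2 z) m +
      2 * ((1 - \<beta>) / (2 * r\<beta>)) * field_deriv (\<psi> rm2) z m"
    by (simp add: G_def Let_def field_deriv_\<phi>t assms hprod_\<psi> smul_def)
  also have "2 * ((1 - \<beta>) / (2 * r\<beta>)) = (1 - \<beta>) / r\<beta>"
    by (simp only: times_divide_eq_right) (rule mult_divide_mult_cancel_left, simp)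
  also have "nprod (linear_comb (current_coeff At z)) (\<psi> rm2 z) m = 1 / rm2 *
      (nprod (linear_comb (current_coeff At z)) (vertex_op 1 z) m -
       nprod (linear_comb (current_coeff At z)) (vertex_op (- 1) z) m)"
    by (simp only: \<psi>_def nexp_\<phi> nprod_linear)
  finally show ?thesis
    by (simp only: field_deriv_\<psi>[OF assms] distrib_left mult.left_commute[of "_ / r\<beta>"])
qed

section \<open>The currents as normally ordered exponentials\<close>

text \<open>The coefficients of \<open>A n\<close> and \<open>At n\<close> in the modes \<open>h\<^sub>i\<^sub>,\<^sub>n\<close> for \<open>n \<noteq> 0\<close>, up to the sign of the former, which is
the difference between \<open>i = 1\<close> and \<open>i = 2\<close>.\<close>

definition A_coeff :: "complex \<Rightarrow> complex \<Rightarrow> int \<Rightarrow> complex" where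
  "A_coeff \<beta> hb n =
     (if n > 0 then (1 + q1 hb powi n) * (1 + q3 \<beta> hb powi n) / (2 * (1 + q2 \<beta> hb powi (- n)))
      else 1)"

definition At_coeff :: "complex \<Rightarrow> complex \<Rightarrow> complex \<Rightarrow> int \<Rightarrow> complex" where
  "At_coeff \<beta> r\<beta> hb n =
     (if n > 0 then r\<beta> / 2 * (1 - q1 hb powi n)
      else (1 - q3 \<beta> hb powi (- n)) / (r\<beta> * (1 + q2 \<beta> hb powi n)))"

definition perp_coeff ::
    "complex \<Rightarrow> complex \<Rightarrow> complex \<Rightarrow> complex \<Rightarrow> int \<Rightarrow> gen \<Rightarrow> complex" where
  "perp_coeff s \<beta> r\<beta> hb n g =
     (if g = A n then s * A_coeff \<beta> hb n
      else if g = At n then At_coeff \<beta> r\<beta> hb n else 0)"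

lemma perp_eq:
  assumes "n \<noteq> 0"
  shows "h1_perp \<beta> r\<beta> hb n = linear_comb (perp_coeff 1 \<beta> r\<beta> hb n)"
    and "h2_perp \<beta> r\<beta> hb n = linear_comb (perp_coeff (- 1) \<beta> r\<beta> hb n)"
proof -
  consider "n > 0" | "n < 0"
    using assms by linarith
  then show "h1_perp \<beta> r\<beta> hb n = linear_comb (perp_coeff 1 \<beta> r\<beta> hb n)"
    and "h2_perp \<beta> r\<beta> hb n = linear_comb (perp_coeff (- 1) \<beta> r\<beta> hb n)"
    by (cases;
        simp add: h1_perp_def h2_perp_def Let_def gen_eq_linear_comb linear_comb_arith;
        rule arg_cong[of _ _ linear_comb];
        simp add: fun_eq_iff perp_coeff_def A_coeff_def At_coeff_def)+
qed

text \<open>The exponents of all four \<open>\<Lambda>\<^sub>i\<^sup>\<plusminus>\<close>: \<open>t = \<plusminus>1\<close> is the sign of \<open>\<Lambda>\<^sub>i\<^sup>\<plusminus>\<close>, and \<open>s\<close> is \<open>1\<close> for \<open>i = 1\<close> and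
\<open>-1\<close> for \<open>i = 2\<close>.\<close>

definition exponent ::
    "int \<Rightarrow> complex \<Rightarrow> complex \<Rightarrow> complex \<Rightarrow> complex \<Rightarrow> complex \<Rightarrow> gen \<Rightarrow> complex" where
  "exponent t s \<beta> r\<beta> z hb g =
     (case g of
        Q \<Rightarrow> of_int t * s
      | Qt \<Rightarrow> 0
      | A n \<Rightarrow>
          if n = 0 then of_int t * s * Ln (q \<beta> hb powi (- t) * z)
          else - (of_int t * s / of_int n * z powi (- n)) * (q \<beta> hb powi (t * n) * A_coeff \<beta> hb n)
      | At n \<Rightarrow>
          if n = 0 then of_int t * (r\<beta> / 2) * Ln (q1 hb)
          else - (of_int t / of_int n * z powi (- n)) * (q \<beta> hb powi (t * n) * At_coeff \<beta> r\<beta> hb n))"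

text \<open>The four factors of \<open>\<Lambda>\<^sub>i\<^sup>\<plusminus>\<close> are already in normal order: \<open>Q\<close> stands to the left of \<open>A 0\<close>, the nonzero
modes commute with the zero modes, and \<open>Qt\<close>, the partner of \<open>At 0\<close>, is absent.\<close>

lemma hprod_zero_modes:
  assumes "\<And>g. mode g = 0 \<Longrightarrow> e g = 0"
  shows "vertex e \<star> hexp (a *\<^sub>H gen Q) \<star> hexp (b *\<^sub>H gen (A 0)) \<star> hexp (d *\<^sub>H gen (At 0)) =
    vertex (\<lambda>g. e g + (if g = Q then a else 0) + (if g = A 0 then b else 0)
      + (if g = At 0 then d else 0))"
proof -
  have partner: "annihilator g \<Longrightarrow> partner g = Q \<Longrightarrow> mode g = 0"
    "annihilator g \<Longrightarrow> partner g \<noteq> A 0" "annihilator g \<Longrightarrow> partner g \<noteq> At 0" for g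
    by (cases g; simp split: if_splits)+
  have "vertex e \<star> hexp (a *\<^sub>H gen Q) = vertex (\<lambda>g. e g + (if g = Q then a else 0))"
    unfolding hexp_smul_gen by (rule vertex_hprod_vertex) (use assms partner in auto)
  moreover have "vertex (\<lambda>g. e g + (if g = Q then a else 0)) \<star> hexp (b *\<^sub>H gen (A 0)) =
      vertex (\<lambda>g. e g + (if g = Q then a else 0) + (if g = A 0 then b else 0))"
    unfolding hexp_smul_gen by (rule vertex_hprod_vertex) (use partner in auto)
  moreover have "vertex (\<lambda>g. e g + (if g = Q then a else 0) + (if g = A 0 then b else 0))
      \<star> hexp (d *\<^sub>H gen (At 0)) = vertex (\<lambda>g. e g + (if g = Q then a else 0)
        + (if g = A 0 then b else 0) + (if g = At 0 then d else 0))"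
    unfolding hexp_smul_gen by (rule vertex_hprod_vertex) (use partner in auto)
  ultimately show ?thesis
    by simp
qed

lemma \<Lambda>_eq_vertex:
  assumes h: "\<And>n. n \<noteq> 0 \<Longrightarrow> h n = linear_comb (perp_coeff s \<beta> r\<beta> hb n)"
    and h0: "h 0 = s *\<^sub>H gen (A 0)"
  shows "\<Lambda>_plus \<beta> r\<beta> hb h (s *\<^sub>H gen Q) z = vertex (exponent 1 s \<beta> r\<beta> z hb)"
    and "\<Lambda>_minus \<beta> r\<beta> hb h (s *\<^sub>H gen Q) z = vertex (exponent (- 1) s \<beta> r\<beta> z hb)"
proof -
  have modes: "sum_nonzero_modes c h = linear_comb (\<lambda>g. if mode g = 0 then 0
      else c (mode g) * perp_coeff s \<beta> r\<beta> hb (mode g) g)" for c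
    by (rule sum_nonzero_modes_linear_comb[OF h]) (auto simp: perp_coeff_def split: if_splits)
  show "\<Lambda>_plus \<beta> r\<beta> hb h (s *\<^sub>H gen Q) z = vertex (exponent 1 s \<beta> r\<beta> z hb)"
    unfolding \<Lambda>_plus_def modes linear_comb_arith nexp_linear_comb hpowr_def h0 a0_perp_def
      smul_minus smul_smul
    by (subst hprod_zero_modes, simp, rule arg_cong[of _ _ vertex])
       (auto simp: exponent_def perp_coeff_def power_int_minus fun_eq_iff split: gen.splits)
  show "\<Lambda>_minus \<beta> r\<beta> hb h (s *\<^sub>H gen Q) z = vertex (exponent (- 1) s \<beta> r\<beta> z hb)"
    unfolding \<Lambda>_minus_def modes linear_comb_arith nexp_linear_comb hpowr_def h0 a0_perp_def
      smul_minus smul_smul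
    by (subst hprod_zero_modes, simp, rule arg_cong[of _ _ vertex])
       (auto simp: exponent_def perp_coeff_def power_int_minus fun_eq_iff split: gen.splits)
qed

section \<open>The first order in the expansion parameter\<close>

text \<open>The coefficients of \<open>s (1 - \<beta>)/2 z \<phi>'(z) + t \<surd>\<beta>/2 z \<phi>t'(z)\<close>, which is the first order of the
exponent.\<close>

definition exponent_deriv ::
    "int \<Rightarrow> complex \<Rightarrow> complex \<Rightarrow> complex \<Rightarrow> complex \<Rightarrow> gen \<Rightarrow> complex" where
  "exponent_deriv t s \<beta> r\<beta> z g =
     s * (1 - \<beta>) / 2 * z * current_coeff A z g + of_int t * r\<beta> / 2 * z * current_coeff At z g"

lemma q_powi:
  "q1 hb powi n = exp (of_int n * hb)"
  "q2 \<beta> hb powi n = exp (of_int n * ((\<beta> - 1) * hb))"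
  "q3 \<beta> hb powi n = exp (of_int n * (- \<beta> * hb))"
  "q \<beta> hb powi n = exp (of_int n * ((\<beta> - 1) * hb / 2))"
  by (simp_all add: q1_def q2_def q3_def q_def exp_power_int)

lemma A_coeff_0 [simp]: "A_coeff \<beta> 0 n = 1"
  by (simp add: A_coeff_def q_powi)

lemma At_coeff_0 [simp]: "At_coeff \<beta> r\<beta> 0 n = 0"
  by (simp add: At_coeff_def q_powi)

lemma mode_coeffs_analytic:
  assumes "r\<beta> \<noteq> 0"
  shows "(\<lambda>hb. A_coeff \<beta> hb n) analytic_on {0}" "(\<lambda>hb. At_coeff \<beta> r\<beta> hb n) analytic_on {0}"
  unfolding A_coeff_def At_coeff_def q_powi
  using assms by (cases "n > 0"; auto intro!: analytic_intros)+

text \<open>The logarithmic derivative at \<open>0\<close> is \<open>n/2 - \<beta> n/2 + (\<beta> - 1) n/2\<close>, which vanishes because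
\<open>q\<^sub>1q\<^sub>2q\<^sub>3 = 1\<close>.\<close>

lemma A_coeff_has_field_derivative:
  "((\<lambda>hb. A_coeff \<beta> hb n) has_field_derivative 0) (at 0)"
proof (cases "n > 0")
  case True
  show ?thesis
    unfolding A_coeff_def q_powi using True
    by (auto intro!: derivative_eq_intros simp: algebra_simps)
qed (simp add: A_coeff_def)

text \<open>For \<open>n < 0\<close> the derivative comes out as \<open>- \<beta> n / (2 r\<beta>)\<close>; this agrees with the formula for \<open>n > 0\<close> since
\<open>r\<beta>\<close> is a square root of \<open>\<beta>\<close>.\<close>

lemma At_coeff_has_field_derivative:
  assumes "r\<beta> ^ 2 = \<beta>" and "r\<beta> \<noteq> 0"
  shows "((\<lambda>hb. At_coeff \<beta> r\<beta> hb n) has_field_derivative - (r\<beta> / 2 * of_int n)) (at 0)"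
proof (cases "n > 0")
  case True
  show ?thesis
    unfolding At_coeff_def q_powi using True
    by (auto intro!: derivative_eq_intros simp: algebra_simps)
next
  case False
  show ?thesis
    unfolding At_coeff_def q_powi using False assms
    by (auto intro!: derivative_eq_intros simp: field_simps power2_eq_square)
qed

lemma exponent_0: "exponent t s \<beta> r\<beta> z 0 g = of_int t * s * boson_coeff Q A z g"
  by (auto simp: exponent_def boson_coeff_def q_def q1_def split: gen.splits)

text \<open>As \<open>z\<close> is off the branch cut, so is \<open>q\<^sup>\<plusminus>\<^sup>1z\<close> for small \<open>\<hbar>\<close>, and the logarithms are analytic there.\<close>

lemma exponent_analytic:
  assumes "r\<beta> \<noteq> 0" and "z \<notin> \<real>\<^sub>\<le>\<^sub>0"
  shows "(\<lambda>hb. exponent t s \<beta> r\<beta> z hb g) analytic_on {0}"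
proof (cases g)
  case (A n)
  then show ?thesis
    using assms mode_coeffs_analytic[OF assms(1)]
    by (cases "n = 0") (auto simp: exponent_def q_powi intro!: analytic_intros)
next
  case (At n)
  then show ?thesis
    using assms mode_coeffs_analytic[OF assms(1)]
    by (cases "n = 0") (auto simp: exponent_def q_powi q1_def intro!: analytic_intros)
qed (auto simp: exponent_def)

text \<open>The factor \<open>q\<^sup>t\<^sup>n\<close> brings in a second sign \<open>t\<close>, which cancels the sign of the coefficient of \<open>A n\<close>. This
is why the part of the derivative in \<open>\<phi>'\<close> depends on \<open>s\<close> only. The coefficient
of \<open>At n\<close> vanishes at \<open>0\<close> already without this factor, so that only the value \<open>1\<close> of \<open>q\<^sup>t\<^sup>n\<close> enters and
the sign \<open>t\<close> survives in the part in \<open>\<phi>t'\<close>.\<close>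

lemma exponent_has_field_derivative:
  assumes "r\<beta> ^ 2 = \<beta>" and "r\<beta> \<noteq> 0" and z: "z \<notin> \<real>\<^sub>\<le>\<^sub>0" and t: "t * t = 1"
  shows "((\<lambda>hb. exponent t s \<beta> r\<beta> z hb g) has_field_derivative exponent_deriv t s \<beta> r\<beta> z g) (at 0)"
proof -
  have [simp]: "z \<noteq> 0"
    using z by auto
  have z_powi: "z * z powi (- n - 1) = z powi (- n)" for n
    using power_int_add_1'[of z "- n - 1"] by simp
  have tt: "of_int t * of_int t = (1 :: complex)"
    using t by (metis of_int_1 of_int_mult)
  show ?thesis
  proof (cases g)
    case (A n)
    have deriv: "exponent_deriv t s \<beta> r\<beta> z g = s * (1 - \<beta>) / 2 * z powi (- n)"
      using A by (simp add: exponent_deriv_def current_coeff_def z_powi mult.assoc)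
    show ?thesis
    proof (cases "n = 0")
      case True
      have "((\<lambda>hb. of_int t * s * Ln (exp (of_int (- t) * ((\<beta> - 1) * hb / 2)) * z))
          has_field_derivative of_int t * s * (- of_int t * (\<beta> - 1) / 2)) (at 0)"
        using z by (auto intro!: derivative_eq_intros)
      also have "of_int t * s * (- of_int t * (\<beta> - 1) / 2) = (of_int t * of_int t) * s * (1 - \<beta>) / 2"
        by (simp add: algebra_simps)
      finally show ?thesis
        unfolding deriv using A True by (simp add: exponent_def q_powi tt)
    next
      case False
      let ?c = "of_int t * s / of_int n * z powi (- n)"
      have "((\<lambda>hb. - ?c * (exp (of_int (t * n) * ((\<beta> - 1) * hb / 2)) * A_coeff \<beta> hb n))
          has_field_derivative - ?c * (of_int (t * n) * (\<beta> - 1) / 2)) (at 0)"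
        by (auto intro!: derivative_eq_intros A_coeff_has_field_derivative)
      also have "- ?c * (of_int (t * n) * (\<beta> - 1) / 2) =
          (of_int t * of_int t) * s * (1 - \<beta>) / 2 * z powi (- n)"
        using False by (simp add: field_simps)
      finally show ?thesis
        unfolding deriv using A False by (simp add: exponent_def q_powi tt)
    qed
  next
    case (At n)
    have deriv: "exponent_deriv t s \<beta> r\<beta> z g = of_int t * r\<beta> / 2 * z powi (- n)"
      using At by (simp add: exponent_deriv_def current_coeff_def z_powi mult.assoc)
    show ?thesis
    proof (cases "n = 0")
      case True
      have "((\<lambda>hb. of_int t * (r\<beta> / 2) * Ln (exp hb))
          has_field_derivative of_int t * (r\<beta> / 2)) (at 0)"
        by (auto intro!: derivative_eq_intros)
      then show ?thesis
        unfolding deriv using At True by (simp add: exponent_def q1_def)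
    next
      case False
      let ?c = "of_int t / of_int n * z powi (- n)"
      have "((\<lambda>hb. - ?c * (exp (of_int (t * n) * ((\<beta> - 1) * hb / 2)) * At_coeff \<beta> r\<beta> hb n))
          has_field_derivative - ?c * - (r\<beta> / 2 * of_int n)) (at 0)"
        by (auto intro!: derivative_eq_intros At_coeff_has_field_derivative assms)
      also have "- ?c * - (r\<beta> / 2 * of_int n) = of_int t * r\<beta> / 2 * z powi (- n)"
        using False by (simp add: field_simps)
      finally show ?thesis
        unfolding deriv using At False by (simp add: exponent_def q_powi)
    qed
  qed (simp_all add: exponent_def exponent_deriv_def current_coeff_def)
qed

text \<open>The two summands \<open>t = \<plusminus>1\<close> have the leading terms \<open>:e\<^sup>t\<^sup>s\<^sup>\<phi>:\<close>. For \<open>s = -1\<close> they are interchanged, so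
that the difference of \<open>:\<phi>t' e\<^sup>\<plusminus>\<^sup>\<phi>:\<close> changes sign, in accordance with the sign of the part in \<open>\<phi>'\<close>.\<close>

lemma current_expansion:
  assumes "r\<beta> ^ 2 = \<beta>" and "r\<beta> \<noteq> 0" and rm2: "rm2 \<noteq> 0" and r2: "r2 \<noteq> 0" and z: "z \<notin> \<real>\<^sub>\<le>\<^sub>0"
    and s: "s = 1 \<or> s = - 1"
  shows "hbar_expansion
    (\<lambda>hb. vertex (exponent 1 s \<beta> r\<beta> z hb) + vertex (exponent (- 1) s \<beta> r\<beta> z hb))
    (r2 *\<^sub>H \<psi>t r2 z) (s *\<^sub>H (rm2 * r\<beta> / 2 * z) *\<^sub>H G \<beta> r\<beta> rm2 z)"
proof (rule hbar_expansionI)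
  fix m
  let ?V = "\<lambda>t hb. vertex (exponent t s \<beta> r\<beta> z hb)"
  have at_0: "?V t 0 = vertex_op (of_int t * s) z" for t
    unfolding vertex_op_def by (rule arg_cong[of _ _ vertex], rule ext, rule exponent_0)
  show "(\<lambda>hb. (?V 1 hb + ?V (- 1) hb) m) analytic_on {0}"
    using assms by (auto intro!: analytic_intros vertex_analytic exponent_analytic)
  show "(?V 1 0 + ?V (- 1) 0) m = (r2 *\<^sub>H \<psi>t r2 z) m"
    using s r2 by (auto simp: at_0 \<psi>t_def nexp_\<phi> smul_def)
  let ?NA = "\<lambda>\<epsilon>. nprod (linear_comb (current_coeff A z)) (vertex_op \<epsilon> z) m"
  let ?NAt = "\<lambda>\<epsilon>. nprod (linear_comb (current_coeff At z)) (vertex_op \<epsilon> z) m"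
  let ?D = "\<lambda>t. s * (1 - \<beta>) / 2 * z * ?NA (of_int t * s) + of_int t * r\<beta> / 2 * z * ?NAt (of_int t * s)"
  have "((\<lambda>hb. ?V t hb m) has_field_derivative ?D t) (at 0)" if "t * t = 1" for t
  proof -
    have "((\<lambda>hb. ?V t hb m) has_field_derivative
        nprod (linear_comb (exponent_deriv t s \<beta> r\<beta> z)) (?V t 0) m) (at 0)"
      by (intro vertex_has_field_derivative exponent_has_field_derivative assms that)
    moreover have "linear_comb (exponent_deriv t s \<beta> r\<beta> z) =
        (s * (1 - \<beta>) / 2 * z) *\<^sub>H linear_comb (current_coeff A z) +
        (of_int t * r\<beta> / 2 * z) *\<^sub>H linear_comb (current_coeff At z)"
      unfolding linear_comb_arith exponent_deriv_def ..
    ultimately show ?thesis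
      by (simp only: at_0 nprod_linear)
  qed
  from DERIV_add[OF this[of 1] this[of "- 1"]]
  have "((\<lambda>hb. (?V 1 hb + ?V (- 1) hb) m) has_field_derivative ?D 1 + ?D (- 1)) (at 0)"
    by simp
  also have "?D 1 + ?D (- 1) = s * (1 - \<beta>) / 2 * z * (?NA 1 + ?NA (- 1)) +
      s * r\<beta> / 2 * z * (?NAt 1 - ?NAt (- 1))"
    using s by (auto simp: algebra_simps)
  also have "\<dots> = (s *\<^sub>H (rm2 * r\<beta> / 2 * z) *\<^sub>H G \<beta> r\<beta> rm2 z) m"
    using rm2 \<open>r\<beta> \<noteq> 0\<close> by (simp add: smul_def G_eq[OF z] field_simps)
  finally show "((\<lambda>hb. (?V 1 hb + ?V (- 1) hb) m) has_field_derivative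
      (s *\<^sub>H (rm2 * r\<beta> / 2 * z) *\<^sub>H G \<beta> r\<beta> rm2 z) m) (at 0)" .
qed

section \<open>The expansions of the currents\<close>

theorem theorem3p6:
  fixes \<beta> r\<beta> r2 rm2 z :: complex
  assumes "\<beta> \<noteq> 0"
    and "r\<beta> ^ 2 = \<beta>" and "r2 ^ 2 = 2" and "rm2 ^ 2 = -2"
    and "z \<notin> \<real>\<^sub>\<le>\<^sub>0"
  shows "hbar_expansion (\<lambda>hb. W1 \<beta> r\<beta> hb z)
           (r2 *\<^sub>H \<psi>t r2 z) ((rm2 * r\<beta> / 2 * z) *\<^sub>H G \<beta> r\<beta> rm2 z)
    \<and> hbar_expansion (\<lambda>hb. W2 \<beta> r\<beta> hb z)
           (r2 *\<^sub>H \<psi>t r2 z) (- ((rm2 * r\<beta> / 2 * z) *\<^sub>H G \<beta> r\<beta> rm2 z))"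
proof -
  have "r\<beta> \<noteq> 0" "rm2 \<noteq> 0" "r2 \<noteq> 0"
    using assms by auto
  note expansion = current_expansion[OF assms(2) this assms(5)]
  have W1: "W1 \<beta> r\<beta> hb z = vertex (exponent 1 1 \<beta> r\<beta> z hb) + vertex (exponent (- 1) 1 \<beta> r\<beta> z hb)" for hb
    using \<Lambda>_eq_vertex[of "h1_perp \<beta> r\<beta> hb" 1 \<beta> r\<beta> hb z, OF perp_eq(1)]
    by (simp add: W1_def smul_1 h1_perp_def)
  have W2: "W2 \<beta> r\<beta> hb z = vertex (exponent 1 (- 1) \<beta> r\<beta> z hb) + vertex (exponent (- 1) (- 1) \<beta> r\<beta> z hb)" for hb
    using \<Lambda>_eq_vertex[of "h2_perp \<beta> r\<beta> hb" "- 1" \<beta> r\<beta> hb z, OF perp_eq(2)]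
    by (simp add: W2_def smul_1 h2_perp_def)
  show ?thesis
    using expansion[of 1] expansion[of "- 1"] by (simp only: W1 W2 smul_1 simp_thms)
qed

end
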